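(* Let $r\ge 1$, $X=\{1,2,\ldots,r\}$, and let $U$ and $S$ be two relations on $X$. The following conditions are equivalent. (i) The statistics $\mathrm{maj}'_U+\mathrm{inv}'_{S\setminus U}$ and $\mathrm{inv}'_S$ are equidistributed on each rearrangement class $\mathcal R(\mathbf c)$. (ii) $S$ is a $\kappa$-extension of $U$.
   Context: $X=\{1,\ldots,r\}$ and $X^*$ is the set of finite words with letters in $X$. A relation on $X$ is a subset of $X\times X$; $x\,U\,y$ means $(x,y)\in U$. $\chi(P)=1$ if $P$ is true and $0$ otherwise. For a relation $U$ and a word $w=x_1\cdots x_n$, $\mathrm{inv}'_U(w)=\sum_{1\le i<j\le n}\chi(x_i\,U\,x_j)$ and $\mathrm{maj}'_U(w)=\sum_{i=1}^{n-1} i\,\chi(x_i\,U\,x_{i+1})$. For a sequence $\mathbf c=(c(1),\ldots,c(r))$ of non-negative integers, $\mathcal R(\mathbf c)$ is the set of all words obtained by permuting the letters of $1^{c(1)}2^{c(2)}\cdots r^{c(r)}$. Two statistics $s,t:X^*\to\mathbb Z_{\ge0}$ are equidistributed on a set $R$ of words if $\sum_{w\in R}q^{s(w)}=\sum_{w\in R}q^{t(w)}$. A relation $S$ on $X$ is a $\kappa$-extension of a relation $U$ on $X$ if (1) $U\subseteq S$ and (2) for all $x,y,z\in X$: if $(x,y)\in U$ and $(z,y)\notin U$, then $(x,z)\in S$ and $(z,x)\notin S$. *)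

theory Defs
  imports "HOL-Library.Multiset" "HOL-Computational_Algebra.Polynomial"
begin

text \<open>
  A word \<open>x\<^sub>1 \<dots> x\<^sub>n\<close> over \<open>X = {1, \<dots>, r}\<close> is a list of naturals. Positions are
  numbered from 1 as usual for the major index, so the letter \<open>x\<^sub>i\<close> is \<open>w ! (i - 1)\<close>.
\<close>

definition alphabet :: "nat \<Rightarrow> nat set" where
  "alphabet r = {1..r}"

definition inv' :: "nat rel \<Rightarrow> nat list \<Rightarrow> nat" where
  "inv' U w = (\<Sum>i = 1..length w. \<Sum>j = i + 1..length w.
     of_bool ((w ! (i - 1), w ! (j - 1)) \<in> U))"

definition maj' :: "nat rel \<Rightarrow> nat list \<Rightarrow> nat" where
  "maj' U w = (\<Sum>i = 1..<length w. i * of_bool ((w ! (i - 1), w ! i) \<in> U))"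

definition sorted_word :: "nat \<Rightarrow> (nat \<Rightarrow> nat) \<Rightarrow> nat list" where
  "sorted_word r c = concat (map (\<lambda>x. replicate (c x) x) [1..<r + 1])"

text \<open>Only the values \<open>c 1, \<dots>, c r\<close> matter here.\<close>

definition rearrangement_class :: "nat \<Rightarrow> (nat \<Rightarrow> nat) \<Rightarrow> nat list set" where
  "rearrangement_class r c = {w. mset w = mset (sorted_word r c)}"

text \<open>
  The generating functions are compared as polynomials in \<open>q\<close>. This is meaningful for
  finite \<open>R\<close> only (sums over infinite sets are 0); rearrangement classes are finite.
\<close>

definition equidistributed_on ::
  "nat list set \<Rightarrow> (nat list \<Rightarrow> nat) \<Rightarrow> (nat list \<Rightarrow> nat) \<Rightarrow> bool" where
  "equidistributed_on R s t \<longleftrightarrow>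
     (\<Sum>w\<in>R. monom 1 (s w) :: int poly) = (\<Sum>w\<in>R. monom 1 (t w))"

definition kappa_extension :: "'a set \<Rightarrow> 'a rel \<Rightarrow> 'a rel \<Rightarrow> bool" where
  "kappa_extension X U S \<longleftrightarrow> U \<subseteq> S \<and>
     (\<forall>x\<in>X. \<forall>y\<in>X. \<forall>z\<in>X. (x, y) \<in> U \<and> (z, y) \<notin> U \<longrightarrow> (x, z) \<in> S \<and> (z, x) \<notin> S)"

end

theory Submission
  imports Defs
begin

text \<open>
  Sufficiency is Foata's second fundamental transformation, where \<open>{x. (x, y) \<in> U}\<close> and its
  complement play the roles of the letters exceeding and not exceeding the new letter \<open>y\<close>; the
  \<open>\<kappa>\<close>-condition says exactly that swapping letters of the two kinds changes \<open>inv' S\<close> by one.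
  For necessity, words of length two give \<open>U \<subseteq> S\<close>. On words \<open>abc\<close> of length three the two statistics
  differ by \<open>\<chi>(b U c) - \<chi>(a U c)\<close>. Compare the sums of their squares over the words with letters
  \<open>x, y, z\<close>: pairing \<open>abc\<close> with \<open>bac\<close> turns the difference of these sums into a sum of nonnegative
  terms, which vanish only if the \<open>\<kappa>\<close>-condition holds.
\<close>

section \<open>The statistics on words\<close>

lemma inv'_snoc:
  "inv' U (w @ [y]) = inv' U w + length (filter (\<lambda>x. (x, y) \<in> U) w)"
proof -
  let ?n = "length w"
  have last: "(\<Sum>i = 1..?n. of_bool ((w ! (i - 1), y) \<in> U)) = length (filter (\<lambda>x. (x, y) \<in> U) w)"
  proof -
    have "(\<Sum>i = 1..?n. of_bool ((w ! (i - 1), y) \<in> U)) = (\<Sum>i<?n. of_bool ((w ! i, y) \<in> U))"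
      by (rule sum.reindex_bij_witness[where i = Suc and j = "\<lambda>i. i - 1"]) auto
    also have "\<dots> = card {i. i < ?n \<and> (w ! i, y) \<in> U}"
      by (simp add: of_bool_def sum.If_cases Int_def)
    finally show ?thesis
      by (simp add: length_filter_conv_card)
  qed
  have "inv' U (w @ [y]) = (\<Sum>i = 1..?n. \<Sum>j = i + 1..Suc ?n.
      of_bool (((w @ [y]) ! (i - 1), (w @ [y]) ! (j - 1)) \<in> U))"
    by (simp add: inv'_def)
  also have "\<dots> = (\<Sum>i = 1..?n. (\<Sum>j = i + 1..?n. of_bool ((w ! (i - 1), w ! (j - 1)) \<in> U))
      + of_bool ((w ! (i - 1), y) \<in> U))"
  proof (rule sum.cong[OF refl])
    fix i assume i: "i \<in> {1..?n}"
    have "(\<Sum>j = i + 1..?n. of_bool (((w @ [y]) ! (i - 1), (w @ [y]) ! (j - 1)) \<in> U))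
        = (\<Sum>j = i + 1..?n. of_bool ((w ! (i - 1), w ! (j - 1)) \<in> U) :: nat)"
      using i by (intro sum.cong) (auto simp: nth_append)
    then show "(\<Sum>j = i + 1..Suc ?n. of_bool (((w @ [y]) ! (i - 1), (w @ [y]) ! (j - 1)) \<in> U))
        = (\<Sum>j = i + 1..?n. of_bool ((w ! (i - 1), w ! (j - 1)) \<in> U))
          + (of_bool ((w ! (i - 1), y) \<in> U) :: nat)"
      using i by (simp add: nth_append Suc_diff_le less_eq_Suc_le)
  qed
  also have "\<dots> = inv' U w + length (filter (\<lambda>x. (x, y) \<in> U) w)"
    by (simp only: sum.distrib last inv'_def)
  finally show ?thesis .
qed

lemma maj'_snoc:
  "maj' U (w @ [y]) = maj' U w + length w * of_bool (w \<noteq> [] \<and> (last w, y) \<in> U)"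
proof (cases "w = []")
  case False
  let ?n = "length w"
  have "{1..<Suc ?n} = insert ?n {1..<?n}"
    using False by (auto simp: Suc_le_eq)
  then have "maj' U (w @ [y]) = (\<Sum>i = 1..<?n. i * of_bool (((w @ [y]) ! (i - 1), (w @ [y]) ! i) \<in> U))
      + ?n * of_bool (((w @ [y]) ! (?n - 1), y) \<in> U)"
    by (simp add: maj'_def)
  also have "(\<Sum>i = 1..<?n. i * of_bool (((w @ [y]) ! (i - 1), (w @ [y]) ! i) \<in> U)) = maj' U w"
    unfolding maj'_def by (rule sum.cong) (auto simp: nth_append)
  also have "(w @ [y]) ! (?n - 1) = last w"
    using False by (simp add: nth_append last_conv_nth)
  finally show ?thesis
    using False by simp
qed (simp add: maj'_def)

lemma inv'_rev_Cons:
  "inv' U (rev (y # v)) = inv' U (rev v) + length (filter (\<lambda>x. (x, y) \<in> U) v)"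
  by (simp add: inv'_snoc flip: rev_filter)

lemma maj'_rev_Cons:
  "maj' U (rev (y # v)) = maj' U (rev v) + length v * of_bool (v \<noteq> [] \<and> (hd v, y) \<in> U)"
  by (simp add: maj'_snoc last_rev)

lemma inv'_Nil [simp]: "inv' U [] = 0"
  by (simp add: inv'_def)

lemma maj'_Nil [simp]: "maj' U [] = 0"
  by (simp add: maj'_def)

section \<open>Rearrangement classes\<close>

lemma finite_mset_eq: "finite {w. mset w = M}"
proof (rule finite_subset)
  show "{w. mset w = M} \<subseteq> {w. set w \<subseteq> set_mset M \<and> length w = size M}"
    by auto
qed (simp add: finite_lists_length_eq)

lemma count_sorted_word:
  "count (mset (sorted_word r c)) x = (if x \<in> alphabet r then c x else 0)"
proof (induction r)
  case (Suc r)
  have "sorted_word (Suc r) c = sorted_word r c @ replicate (c (Suc r)) (Suc r)"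
    by (simp add: sorted_word_def)
  then show ?case
    using Suc by (auto simp: alphabet_def)
qed (simp add: sorted_word_def alphabet_def)

text \<open>Taking the multiplicities from \<open>M\<close> gives access to the class of any chosen
  word, as the necessity proof requires.\<close>

lemma rearrangement_class_count:
  assumes "set_mset M \<subseteq> alphabet r"
  shows "rearrangement_class r (count M) = {w. mset w = M}"
proof -
  have "mset (sorted_word r (count M)) = M"
    using assms by (intro multiset_eqI) (auto simp: count_sorted_word not_in_iff)
  then show ?thesis
    by (simp add: rearrangement_class_def)
qed

lemma set_rearrangement_class:
  assumes "w \<in> rearrangement_class r c"
  shows "set w \<subseteq> alphabet r"
proof
  fix x assume "x \<in> set w"
  then have "count (mset w) x \<noteq> 0"
    by simp
  moreover have "mset w = mset (sorted_word r c)"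
    using assms by (simp add: rearrangement_class_def)
  ultimately show "x \<in> alphabet r"
    by (simp only: count_sorted_word split: if_splits)
qed

section \<open>Foata's transformation\<close>

text \<open>
  Words are written backwards here, so that the letter appended last is the head of the list.
  Each letter satisfying \<open>P\<close>, starting with \<open>a\<close>, is moved past the run of letters violating \<open>P\<close>
  that follows it.
\<close>

fun carry :: "('a \<Rightarrow> bool) \<Rightarrow> 'a \<Rightarrow> 'a list \<Rightarrow> 'a list" where
  "carry P a [] = [a]"
| "carry P a (x # xs) = (if P x then a # carry P x xs else x # carry P a xs)"

text \<open>Foata cuts the word at the letters of the same kind as its last letter, here the head
  \<open>x\<close>. So the predicate given to \<open>carry\<close> holds for \<open>x\<close>
  whether or not \<open>P x\<close> does.\<close>

fun foata_step :: "('a \<Rightarrow> bool) \<Rightarrow> 'a list \<Rightarrow> 'a list" where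
  "foata_step P [] = []"
| "foata_step P (x # xs) = carry (\<lambda>t. P t = P x) x xs"

fun foata :: "'a rel \<Rightarrow> 'a list \<Rightarrow> 'a list" where
  "foata U [] = []"
| "foata U (y # v) = y # foata_step (\<lambda>x. (x, y) \<in> U) (foata U v)"

section \<open>Injectivity of the transformation\<close>

lemma mset_carry [simp]: "mset (carry P a xs) = add_mset a (mset xs)"
  by (induction P a xs rule: carry.induct) auto

lemma carry_neq_Nil [simp]: "carry P a xs \<noteq> []" "[] \<noteq> carry P a xs"
  by (cases xs; auto)+

text \<open>Lets the kind of the original head be read off the image, so that
  \<open>foata_step\<close> can be inverted.\<close>

lemma last_carry: "P a \<Longrightarrow> P (last (carry P a xs))"
  by (induction P a xs rule: carry.induct) auto

text \<open>Decoding from the front: a letter violating \<open>P\<close> was copied, while a letter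
  satisfying \<open>P\<close> is the carried one being put down.\<close>

lemma carry_inject:
  "P a \<Longrightarrow> P b \<Longrightarrow> carry P a xs = carry P b ys \<Longrightarrow> a = b \<and> xs = ys"
proof (induction xs arbitrary: a b ys)
  case Nil
  then show ?case by (cases ys) (auto split: if_splits)
next
  case (Cons x xs)
  then show ?case by (cases ys) (auto split: if_splits)
qed

lemma mset_foata_step [simp]: "mset (foata_step P xs) = mset xs"
  by (cases xs) auto

lemma foata_step_inject:
  assumes eq: "foata_step P xs = foata_step P ys"
  shows "xs = ys"
proof (cases xs)
  case Nil
  then show ?thesis
    using eq by (cases ys) auto
next
  case (Cons x xs')
  then obtain y ys' where ys: "ys = y # ys'"
    using eq by (cases ys) auto
  have "P (last (foata_step P xs)) = P x" "P (last (foata_step P ys)) = P y"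
    using last_carry[of "\<lambda>t. P t = P x" x xs'] last_carry[of "\<lambda>t. P t = P y" y ys']
    by (simp_all add: Cons ys)
  then have "P x = P y"
    using eq by simp
  then show ?thesis
    using eq carry_inject[of "\<lambda>t. P t = P y" x y xs' ys'] by (simp add: Cons ys)
qed

lemma mset_foata [simp]: "mset (foata U v) = mset v"
  by (induction v) auto

lemma foata_inject: "foata U v = foata U w \<Longrightarrow> v = w"
proof (induction v arbitrary: w)
  case Nil
  then show ?case by (cases w) auto
next
  case (Cons x v)
  then show ?case by (cases w) (auto dest: foata_step_inject)
qed

section \<open>Inversions under the transformation\<close>

lemma length_filter_cong_mset:
  "mset xs = mset ys \<Longrightarrow> length (filter P xs) = length (filter P ys)"
  by (metis mset_filter size_mset)

text \<open>Each letter violating \<open>P\<close> is passed by exactly one carried letter. In the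
  word read forwards, the pair \<open>x\<close>, \<open>a\<close> becomes \<open>a\<close>,
  \<open>x\<close>, which contributes \<open>e\<close>; all other pairs keep their order.\<close>

lemma inv'_carry:
  fixes e :: int
  assumes "\<And>a x. a \<in> A \<Longrightarrow> x \<in> A \<Longrightarrow> P a \<Longrightarrow> \<not> P x \<Longrightarrow>
      of_bool ((a, x) \<in> S) - of_bool ((x, a) \<in> S) = e"
    and "P a" "a \<in> A" "set xs \<subseteq> A"
  shows "int (inv' S (rev (carry P a xs)))
    = int (inv' S (rev (a # xs))) + e * int (length (filter (\<lambda>t. \<not> P t) xs))"
  using assms(2-)
proof (induction xs arbitrary: a)
  case (Cons x xs)
  show ?case
  proof (cases "P x")
    case True
    have "length (filter (\<lambda>t. (t, a) \<in> S) (carry P x xs)) = length (filter (\<lambda>t. (t, a) \<in> S) (x # xs))"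
      by (rule length_filter_cong_mset) simp
    then show ?thesis
      using Cons.IH[of x] Cons.prems True
      by (simp only: carry.simps if_True inv'_rev_Cons) simp
  next
    case False
    have "length (filter (\<lambda>t. (t, x) \<in> S) (carry P a xs)) = length (filter (\<lambda>t. (t, x) \<in> S) (a # xs))"
      by (rule length_filter_cong_mset) simp
    moreover have "of_bool ((a, x) \<in> S) - of_bool ((x, a) \<in> S) = e"
      using assms(1) Cons.prems False by simp
    ultimately show ?thesis
      using Cons.IH[of a] Cons.prems False
      by (simp only: carry.simps if_False inv'_rev_Cons) (simp add: algebra_simps, simp add: of_bool_def split: if_splits)
  qed
qed simp

text \<open>If \<open>P (hd v)\<close>, letters with \<open>P\<close> pass those without it, and
  each passage gains one inversion; otherwise the roles are exchanged and each passage loses one.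
  Adding the number of letters with \<open>P\<close> gives a net change of \<open>length v\<close>
  or 0, the increment of \<open>maj' U\<close> when \<open>y\<close> is appended.\<close>

lemma inv'_foata_step:
  assumes kappa: "kappa_extension X U S" and "y \<in> X" "set v \<subseteq> X"
  defines "P \<equiv> \<lambda>x. (x, y) \<in> U"
  shows "int (inv' S (rev (foata_step P v))) + int (length (filter P v))
    = int (inv' S (rev v)) + int (length v) * of_bool (v \<noteq> [] \<and> P (hd v))"
proof (cases v)
  case (Cons x xs)
  have *: "(a, b) \<in> S \<and> (b, a) \<notin> S" if "a \<in> X" "b \<in> X" "P a" "\<not> P b" for a b
    using kappa that \<open>y \<in> X\<close> unfolding kappa_extension_def P_def by blast
  have "int (inv' S (rev (foata_step P v)))
    = int (inv' S (rev v)) + (if P x then 1 else - 1) * int (length (filter (\<lambda>t. P t \<noteq> P x) xs))"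
    unfolding Cons foata_step.simps
  proof (rule inv'_carry[where A = X])
    show "of_bool ((a, t) \<in> S) - of_bool ((t, a) \<in> S) = (if P x then 1 else - 1 :: int)"
      if "a \<in> X" "t \<in> X" "P a = P x" "P t \<noteq> P x" for a t
      using *[of a t] *[of t a] that by (cases "P x") auto
  qed (use Cons assms(3) in auto)
  moreover have "length (filter P xs) + length (filter (\<lambda>t. \<not> P t) xs) = length xs"
    by (rule sum_length_filter_compl)
  ultimately show ?thesis
    by (cases "P x") (simp_all add: Cons)
qed simp

text \<open>The transformation fixes the last letter of the word, so the next letter meets the same
  \<open>U\<close>-relation before and after it.\<close>

lemma hd_foata: "hd (foata U v) = hd v"
  by (cases v) auto

lemma foata_eq_Nil_iff [simp]: "foata U v = [] \<longleftrightarrow> v = []"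
  by (cases v) auto

text \<open>Appending \<open>y\<close> adds the number of \<open>x\<close> with
  \<open>(x, y)\<close> in \<open>S\<close>. Its \<open>U\<close>-part turns the change made by
  \<open>foata_step\<close> into the increment of \<open>maj' U\<close>; its \<open>S - U\<close>
  part is the increment of \<open>inv' (S - U)\<close>.\<close>

lemma inv'_foata:
  assumes kappa: "kappa_extension X U S" and "set v \<subseteq> X"
  shows "inv' S (rev (foata U v)) = maj' U (rev v) + inv' (S - U) (rev v)"
  using assms(2)
proof (induction v)
  case (Cons y v)
  define P where "P = (\<lambda>x. (x, y) \<in> U)"
  define w where "w = foata U v"
  have mset_w: "mset w = mset v"
    by (simp add: w_def)
  have set_w: "set w = set v" and length_w: "length w = length v"
    using mset_w by (metis set_mset_mset, metis size_mset)
  have step: "int (inv' S (rev (foata_step P w))) + int (length (filter P v))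
      = int (inv' S (rev w)) + int (length v) * of_bool (v \<noteq> [] \<and> P (hd v))"
    using inv'_foata_step[OF kappa, of y w] Cons.prems set_w length_w
      length_filter_cong_mset[OF mset_w, of P]
    by (simp add: P_def w_def hd_foata)
  have US: "U \<subseteq> S"
    using kappa by (simp add: kappa_extension_def)
  have split: "length (filter (\<lambda>x. (x, y) \<in> S) v)
      = length (filter P v) + length (filter (\<lambda>x. (x, y) \<in> S - U) v)"
    using US unfolding P_def by (induction v) auto
  have "length (filter (\<lambda>x. (x, y) \<in> S) (foata_step P w)) = length (filter (\<lambda>x. (x, y) \<in> S) v)"
    by (rule length_filter_cong_mset) (simp add: mset_w)
  then have "inv' S (rev (foata U (y # v)))
      = inv' S (rev (foata_step P w)) + length (filter (\<lambda>x. (x, y) \<in> S) v)"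
    by (simp only: foata.simps inv'_rev_Cons flip: P_def w_def)
  moreover have "inv' S (rev w) = maj' U (rev v) + inv' (S - U) (rev v)"
    using Cons by (simp add: w_def)
  ultimately have "int (inv' S (rev (foata U (y # v))))
      = int (maj' U (rev (y # v)) + inv' (S - U) (rev (y # v)))"
    unfolding maj'_rev_Cons inv'_rev_Cons using step split by (simp add: P_def)
  then show ?case
    by (simp only: of_nat_eq_iff)
qed simp

lemma equidistributed_on_if_kappa_extension:
  assumes "kappa_extension (alphabet r) U S"
  shows "equidistributed_on (rearrangement_class r c)
    (\<lambda>w. maj' U w + inv' (S - U) w) (inv' S)"
proof -
  let ?R = "rearrangement_class r c" and ?f = "\<lambda>w. rev (foata U (rev w))"
  have "inj_on ?f ?R"
    by (auto intro!: inj_onI dest: foata_inject)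
  moreover have "?f ` ?R \<subseteq> ?R"
    by (auto simp: rearrangement_class_def)
  moreover have "finite ?R"
    unfolding rearrangement_class_def by (rule finite_mset_eq)
  ultimately have bij: "bij_betw ?f ?R ?R"
    by (simp add: bij_betw_def endo_inj_surj)
  have "(\<Sum>w\<in>?R. monom 1 (maj' U w + inv' (S - U) w) :: int poly) = (\<Sum>w\<in>?R. monom 1 (inv' S (?f w)))"
  proof (rule sum.cong[OF refl])
    fix w assume "w \<in> ?R"
    then show "monom 1 (maj' U w + inv' (S - U) w) = (monom 1 (inv' S (?f w)) :: int poly)"
      using inv'_foata[OF assms, of "rev w"] set_rearrangement_class[of w r c] by simp
  qed
  also have "\<dots> = (\<Sum>w\<in>?R. monom 1 (inv' S w))"
    by (rule sum.reindex_bij_betw[OF bij])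
  finally show ?thesis
    by (simp add: equidistributed_on_def)
qed

section \<open>Necessity of the \<open>\<kappa>\<close>-condition\<close>

text \<open>Equal coefficients mean equal multisets of values, hence equal sums of any function of
  the values. It is applied to first and second moments.\<close>

lemma equidistributed_on_sum_eq:
  fixes g :: "nat \<Rightarrow> 'b::comm_monoid_add"
  assumes "finite R" "equidistributed_on R s t"
  shows "(\<Sum>w\<in>R. g (s w)) = (\<Sum>w\<in>R. g (t w))"
proof -
  have count: "int (count (image_mset u (mset_set R)) n) = coeff (\<Sum>w\<in>R. monom 1 (u w)) n"
    for u :: "nat list \<Rightarrow> nat" and n
    using \<open>finite R\<close> by (induction R rule: finite_induct) auto
  have "int (count (image_mset s (mset_set R)) n) = int (count (image_mset t (mset_set R)) n)" for n
    using assms(2) unfolding count equidistributed_on_def by simp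
  then have "image_mset s (mset_set R) = image_mset t (mset_set R)"
    by (intro multiset_eqI) simp
  then have "sum_mset (image_mset g (image_mset s (mset_set R)))
      = sum_mset (image_mset g (image_mset t (mset_set R)))"
    by simp
  then show ?thesis
    by (simp add: sum_unfold_sum_mset image_mset.compositionality o_def)
qed

section \<open>Words of length two and three\<close>

lemma inv'_two: "inv' U [a, b] = of_bool ((a, b) \<in> U)"
  using inv'_snoc[of U "[a]" b] inv'_snoc[of U "[]" a] by simp

lemma maj'_two: "maj' U [a, b] = of_bool ((a, b) \<in> U)"
  using maj'_snoc[of U "[a]" b] maj'_snoc[of U "[]" a] by simp

lemma inv'_three:
  "inv' U [a, b, c] = of_bool ((a, b) \<in> U) + of_bool ((a, c) \<in> U) + of_bool ((b, c) \<in> U)"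
  using inv'_snoc[of U "[a, b]" c] by (simp add: inv'_two)

lemma maj'_three: "maj' U [a, b, c] = of_bool ((a, b) \<in> U) + 2 * of_bool ((b, c) \<in> U)"
  using maj'_snoc[of U "[a, b]" c] by (simp add: maj'_two)

lemma subset_if_equidistributed:
  assumes "a \<in> alphabet r" "b \<in> alphabet r" "(a, b) \<in> U"
    and "\<And>c. equidistributed_on (rearrangement_class r c)
      (\<lambda>w. maj' U w + inv' (S - U) w) (inv' S)"
  shows "(a, b) \<in> S"
proof -
  let ?R = "{w. mset w = {#a, b#}}"
  have fin: "finite ?R"
    by (rule finite_mset_eq)
  have eq: "equidistributed_on ?R (\<lambda>w. maj' U w + inv' (S - U) w) (inv' S)"
    using assms(1,2) assms(4)[of "count {#a, b#}"] rearrangement_class_count[of "{#a, b#}" r]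
    by simp
  \<comment> \<open>On two letters the left statistic is the indicator of the union of
    \<open>U\<close> and \<open>S\<close>. Pointwise inequality with equal sums forces equality at
    every word.\<close>
  have le: "inv' S w \<le> maj' U w + inv' (S - U) w" if "w \<in> ?R" for w
  proof -
    have "length w = 2"
      using that by (simp flip: size_mset)
    then obtain p q where "w = [p, q]"
      by (auto simp: numeral_2_eq_2 length_Suc_conv)
    then show ?thesis
      by (simp add: inv'_two maj'_two of_bool_def)
  qed
  have "maj' U [a, b] + inv' (S - U) [a, b] = inv' S [a, b]"
  proof (rule ccontr)
    assume "\<not> ?thesis"
    then have "inv' S [a, b] < maj' U [a, b] + inv' (S - U) [a, b]"
      using le[of "[a, b]"] by (simp add: order.not_eq_order_implies_strict)
    then have "(\<Sum>w\<in>?R. inv' S w) < (\<Sum>w\<in>?R. maj' U w + inv' (S - U) w)"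
      by (intro sum_strict_mono_ex1[OF fin] ballI le bexI[of _ "[a, b]"]) simp_all
    then show False
      using equidistributed_on_sum_eq[OF fin eq, of "\<lambda>n. n"] by simp
  qed
  then show ?thesis
    using \<open>(a, b) \<in> U\<close> by (simp add: inv'_two maj'_two of_bool_def split: if_splits)
qed

lemma kappa_condition_if_equidistributed:
  assumes "x \<in> alphabet r" "y \<in> alphabet r" "z \<in> alphabet r"
    and "U \<subseteq> S" "(x, y) \<in> U" "(z, y) \<notin> U"
    and "\<And>c. equidistributed_on (rearrangement_class r c)
      (\<lambda>w. maj' U w + inv' (S - U) w) (inv' S)"
  shows "(x, z) \<in> S \<and> (z, x) \<notin> S"
proof -
  let ?R = "{w. mset w = {#z, x, y#}}"
  define m where "m w = maj' U w + inv' (S - U) w" for w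
  define swap :: "nat list \<Rightarrow> nat list" where "swap w = [w ! 1, w ! 0, w ! 2]" for w
  \<comment> \<open>First moments give no information here: the difference of the two statistics
    changes sign under \<open>swap\<close>, so it always sums to 0.\<close>
  define F where "F w = (int (m w))\<^sup>2 - (int (inv' S w))\<^sup>2" for w
  have fin: "finite ?R"
    by (rule finite_mset_eq)
  have eq: "equidistributed_on ?R m (inv' S)"
    using assms(1-3) assms(7)[of "count {#z, x, y#}"] rearrangement_class_count[of "{#z, x, y#}" r]
    by (simp add: m_def[abs_def])
  have three: "\<exists>a b c. w = [a, b, c]" if "w \<in> ?R" for w
  proof -
    have "length w = 3"
      using that by (simp flip: size_mset)
    then show ?thesis
      by (auto simp: numeral_3_eq_3 length_Suc_conv)
  qed
  have swap_in: "swap w \<in> ?R" and swap_swap: "swap (swap w) = w" if "w \<in> ?R" for w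
    using three[OF that] that by (auto simp: swap_def add_mset_commute)
  have m_three: "int (m [a, b, c]) = int (inv' S [a, b, c]) + of_bool ((b, c) \<in> U) - of_bool ((a, c) \<in> U)"
    for a b c
    using \<open>U \<subseteq> S\<close> by (auto simp: m_def maj'_three inv'_three)
  \<comment> \<open>The swap changes \<open>inv' S\<close> only through the pair \<open>a\<close>,
    \<open>b\<close>. If exactly one of them is \<open>U\<close>-related to \<open>c\<close>, the
    two differences of squares are 2i + 1 and -2j + 1 in some order, where i and j are the values of
    \<open>inv' S\<close> on the corresponding words.\<close>
  have F: "F [a, b, c] + F (swap [a, b, c]) =
      (if ((a, c) \<in> U) = ((b, c) \<in> U) then 0
       else if (b, c) \<in> U then 2 * (of_bool ((a, b) \<in> S) - of_bool ((b, a) \<in> S) + 1)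
       else 2 * (of_bool ((b, a) \<in> S) - of_bool ((a, b) \<in> S) + 1))" for a b c
  proof -
    have "int (inv' S [a, b, c]) =
        int (inv' S [b, a, c]) + of_bool ((a, b) \<in> S) - of_bool ((b, a) \<in> S)"
      by (simp add: inv'_three)
    then show ?thesis
      by (cases "(a, c) \<in> U"; cases "(b, c) \<in> U")
        (simp_all add: F_def swap_def m_three power2_eq_square algebra_simps)
  qed
  have nonneg: "F w + F (swap w) \<ge> 0" if "w \<in> ?R" for w
    using three[OF that] F by (auto split: if_splits)
  have "(\<Sum>w\<in>?R. F w) = 0"
    using equidistributed_on_sum_eq[OF fin eq, of "\<lambda>n. (int n)\<^sup>2"]
    by (simp add: F_def sum_subtractf)
  moreover have "(\<Sum>w\<in>?R. F (swap w)) = (\<Sum>w\<in>?R. F w)"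
    by (rule sum.reindex_bij_witness[where i = swap and j = swap]) (use swap_in swap_swap in auto)
  ultimately have "(\<Sum>w\<in>?R. F w + F (swap w)) = 0"
    by (simp add: sum.distrib)
  \<comment> \<open>This word falls under the second case of \<open>F\<close>, where the sum
    vanishes only if \<open>(x, z)\<close> is in \<open>S\<close> and \<open>(z, x)\<close> is
    not.\<close>
  then have "F [z, x, y] + F (swap [z, x, y]) = 0"
    using nonneg fin sum_nonneg_eq_0_iff[of ?R "\<lambda>w. F w + F (swap w)"] by simp
  then show ?thesis
    using assms(5,6) F[of z x y] by (auto simp: of_bool_def split: if_splits)
qed

theorem theorem1p6:
  fixes r :: nat and U S :: "nat rel"
  assumes "r \<ge> 1"
    and "U \<subseteq> alphabet r \<times> alphabet r"
    and "S \<subseteq> alphabet r \<times> alphabet r"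
  shows "(\<forall>c. equidistributed_on (rearrangement_class r c)
            (\<lambda>w. maj' U w + inv' (S - U) w) (inv' S))
         \<longleftrightarrow> kappa_extension (alphabet r) U S"
proof
  assume eq: "\<forall>c. equidistributed_on (rearrangement_class r c)
    (\<lambda>w. maj' U w + inv' (S - U) w) (inv' S)"
  have "U \<subseteq> S"
    using assms(2) eq subset_if_equidistributed[of _ r _ U S] by auto
  then show "kappa_extension (alphabet r) U S"
    using eq kappa_condition_if_equidistributed[of _ r _ _ U S]
    unfolding kappa_extension_def by blast
qed (simp add: equidistributed_on_if_kappa_extension)

end
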